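(* Let $n\ge2$, let $d\in\mathbb{N}_n$ be prime to $n$, and let $l\in\mathbb{N}_n$. Write $n=sd+t$ and $l=pd+q$ with $t,q\in\mathbb{N}_d$ and integers $s,p\ge0$. Then $$f^{(n)}_{d}(l)=\frac{l(n+d-1-l)}{d}-\frac{n}{d}f^{(d)}_{t}(q)$$ and $$f^{(n)}_{n-d}(l)=\frac{n}{d}f^{(d)}_{t}(q)-\frac{l(n-d-1-l)}{d}.$$
   Context: For an integer $m\ge1$, $\mathbb{N}_m=\{0,1,\dots,m-1\}$. For $m\ge1$ and $c\in\mathbb{N}_m$ prime to $m$ (for $m=1$, $c=0$), $f^{(m)}_c:\mathbb{N}_m\to\mathbb{Z}$ is the unique function satisfying $f^{(m)}_c(0)=0$ and, for every $l\in\mathbb{N}_m$: (1) $f^{(m)}_c(l')=f^{(m)}_c(l)$, where $l'\in\mathbb{N}_m$ is the residue of $c-1-l$ modulo $m$; (2) $f^{(m)}_c(l'')+l=f^{(m)}_c(l)+m-1-l$, where $l''\in\mathbb{N}_m$ is the residue of $l+c$ modulo $m$. *)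

theory Defs
  imports Complex_Main "HOL-Library.FuncSet" "HOL-Number_Theory.Cong"
begin

text \<open>
  The set \<open>\<nat>\<^sub>m = {0, ..., m - 1}\<close> is \<open>{..<m}\<close>. The residue of \<open>c - 1 - l\<close> is taken over the
  integers, because \<open>c - 1 - l\<close> may be negative.
\<close>

definition is_residue_fun :: "nat \<Rightarrow> nat \<Rightarrow> (nat \<Rightarrow> int) \<Rightarrow> bool" where
  "is_residue_fun m c f \<longleftrightarrow>
     f 0 = 0 \<and>
     (\<forall>l\<in>{..<m}.
        f (nat ((int c - 1 - int l) mod int m)) = f l \<and>
        f ((l + c) mod m) + int l = f l + int m - 1 - int l)"

text \<open>
  Functions on \<open>{..<m}\<close> are extensional functions on \<open>nat\<close>, so values at arguments
  \<open>l \<ge> m\<close> carry no information. The description is meaningful for \<open>1 \<le> m\<close>, \<open>c < m\<close> and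
  \<open>coprime c m\<close>; see \<open>residue_fun_ex1\<close>.
\<close>

definition residue_fun :: "nat \<Rightarrow> nat \<Rightarrow> nat \<Rightarrow> int" where
  "residue_fun m c = (THE f. f \<in> {..<m} \<rightarrow>\<^sub>E UNIV \<and> is_residue_fun m c f)"

lemma is_residue_fun_unique:
  assumes m: "1 \<le> m" and cop: "coprime c m"
    and f: "is_residue_fun m c f" and g: "is_residue_fun m c g" and l: "l < m"
  shows "f l = g l"
proof -
  have step: "f (j * c mod m) = g (j * c mod m)" for j
  proof (induction j)
    case 0
    then show ?case using f g by (simp add: is_residue_fun_def)
  next
    case (Suc j)
    have lt: "j * c mod m < m" using m by simp
    have e: "Suc j * c mod m = (j * c mod m + c) mod m"
      by (simp add: mod_add_right_eq add.commute)
    have "h (Suc j * c mod m) = h (j * c mod m) + int m - 1 - 2 * int (j * c mod m)"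
      if "is_residue_fun m c h" for h
    proof -
      have "h ((j * c mod m + c) mod m) + int (j * c mod m)
              = h (j * c mod m) + int m - 1 - int (j * c mod m)"
        using that lt unfolding is_residue_fun_def by blast
      then show ?thesis unfolding e by linarith
    qed
    from this[OF f] this[OF g] Suc.IH show ?case by simp
  qed
  obtain c' where "[c * c' = 1] (mod m)"
    using cong_solve_coprime_nat[OF cop] by auto
  then have "[l * (c * c') = l * 1] (mod m)" by (rule cong_scalar_left)
  then have "(l * c') * c mod m = l"
    using l by (simp add: cong_def ac_simps)
  with step[of "l * c'"] show ?thesis by simp
qed

lemma is_residue_fun_exists:
  assumes m: "1 \<le> m" and cop: "coprime c m"
  obtains f where "is_residue_fun m c f"
proof -
  define h where "h k = (\<Sum>j<k. int m - 1 - 2 * int (j * c mod m))" for k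
  have "inj_on (\<lambda>j. j * c mod m) {..<m}"
  proof (rule inj_onI)
    fix x y assume xy: "x \<in> {..<m}" "y \<in> {..<m}" "x * c mod m = y * c mod m"
    then have "[x = y] (mod m)"
      using cong_mult_rcancel_nat[of c m x y] cop by (simp add: cong_def)
    with xy show "x = y" by (simp add: cong_def)
  qed
  moreover have "(\<lambda>j. j * c mod m) ` {..<m} \<subseteq> {..<m}" using m by auto
  ultimately have "bij_betw (\<lambda>j. j * c mod m) {..<m} {..<m}"
    by (simp add: bij_betw_def endo_inj_surj)
  then have "(\<Sum>j<m. int (j * c mod m)) = (\<Sum>i<m. int i)"
    by (rule sum.reindex_bij_betw)
  moreover have "2 * (\<Sum>i<k. int i) = int k * (int k - 1)" for k
    by (induction k) (auto simp: algebra_simps)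
  ultimately have hm: "h m = 0"
    by (simp add: h_def sum_subtractf flip: sum_distrib_left)
  obtain c' where "[c * c' = 1] (mod m)"
    using cong_solve_coprime_nat[OF cop] by auto
  then have c': "[int c * int c' = 1] (mod int m)"
    by (metis cong_int_iff of_nat_1 of_nat_mult)
  define G where "G x = h (nat (x * int c' mod int m))" for x
  have G_mod: "G (x mod int m) = G x" for x
    by (simp add: G_def mod_mult_left_eq)
  have G0: "G 0 = 0" by (simp add: G_def h_def)
  have G_step: "G (x + int c) = G x + int m - 1 - 2 * (x mod int m)" for x
  proof -
    define k where "k = nat (x * int c' mod int m)"
    have k: "int k = x * int c' mod int m" using m by (simp add: k_def)
    then have km: "k < m" using m by (metis Euclidean_Rings.pos_mod_bound of_nat_0_less_iff
          of_nat_less_iff less_le_trans zero_less_one)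
    have "[x * (int c * int c') = x * 1] (mod int m)"
      using c' by (rule cong_scalar_left)
    then have "int (k * c mod m) = x mod int m"
      by (simp add: zmod_int k mod_mult_right_eq cong_def ac_simps)
    then have hS: "h (Suc k) = h k + int m - 1 - 2 * (x mod int m)"
      by (simp add: h_def)
    have "[(x + int c) * int c' = int k + 1] (mod int m)"
      unfolding distrib_right by (rule cong_add) (use c' k in \<open>auto simp: cong_def\<close>)
    then have "(x + int c) * int c' mod int m = int (Suc k mod m)"
      by (simp add: cong_def zmod_int add.commute)
    then have "G (x + int c) = h (Suc k mod m)" by (simp add: G_def)
    also have "\<dots> = h (Suc k)"
    proof (cases "Suc k = m")
      case True
      then show ?thesis using hm by (simp add: h_def)
    next
      case False
      then show ?thesis using km by simp
    qed
    finally show ?thesis using hS by (simp add: G_def k_def)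
  qed
  define D where "D x = G (int c - 1 - x) - G x" for x
  have D_step: "D (x + int c) = D x" for x
  proof -
    have "(- 1 - x) mod int m = int m - 1 - x mod int m"
    proof -
      have "(- 1 - x) mod int m = (int m - 1 - x mod int m) mod int m"
        by (metis add_uminus_conv_diff diff_add_eq minus_mod_self1 mod_add_self2 mod_diff_right_eq
            add.commute uminus_add_conv_diff)
      also have "\<dots> = int m - 1 - x mod int m"
        using m pos_mod_bound[of "int m" x] pos_mod_sign[of "int m" x]
        by (intro mod_pos_pos_trivial) linarith+
      finally show ?thesis .
    qed
    with G_step[of "- 1 - x"] G_step[of x] show ?thesis
      by (simp add: D_def algebra_simps)
  qed
  have D_mult: "D (int j * int c) = D 0" for j
  proof (induction j)
    case (Suc j)
    then show ?case using D_step[of "int j * int c"] by (simp add: algebra_simps)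
  qed simp
  have D_mod: "D x = D y" if "[x = y] (mod int m)" for x y
  proof -
    have "[int c - 1 - x = int c - 1 - y] (mod int m)"
      using that by (intro cong_diff) auto
    with that show ?thesis
      unfolding D_def cong_def by (metis G_mod)
  qed
  have D_const: "D x = D 0" for x
  proof -
    define j where "j = nat (x * int c' mod int m)"
    have "[x * (int c * int c') = x * 1] (mod int m)"
      using c' by (rule cong_scalar_left)
    then have "[int j * int c = x] (mod int m)"
      using m by (simp add: j_def cong_def mod_mult_right_eq ac_simps)
    from D_mod[OF this] D_mult[of j] show ?thesis by simp
  qed
  have "D (int c - 1) = - D 0" by (simp add: D_def)
  with D_const have D0: "D x = 0" for x
    by (metis eq_neg_iff_add_eq_0 double_zero)
  have "is_residue_fun m c (\<lambda>l. G (int l))"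
    unfolding is_residue_fun_def
  proof (intro conjI ballI)
    show "G (int 0) = 0" using G0 by simp
  next
    fix l assume l: "l \<in> {..<m}"
    show "G (int (nat ((int c - 1 - int l) mod int m))) = G (int l)"
      using D0[of "int l"] m by (simp add: D_def G_mod)
    show "G (int ((l + c) mod m)) + int l = G (int l) + int m - 1 - int l"
      using G_step[of "int l"] l by (simp add: zmod_int G_mod)
  qed
  then show ?thesis by (rule that)
qed

lemma residue_fun_ex1:
  assumes m: "1 \<le> m" and cop: "coprime c m"
  shows "\<exists>!f. f \<in> {..<m} \<rightarrow>\<^sub>E UNIV \<and> is_residue_fun m c f"
proof (rule ex_ex1I)
  obtain f where f: "is_residue_fun m c f"
    using is_residue_fun_exists[OF m cop] .
  have "is_residue_fun m c (restrict f {..<m})"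
    using f m by (auto simp: is_residue_fun_def nat_less_iff)
  then show "\<exists>f. f \<in> {..<m} \<rightarrow>\<^sub>E UNIV \<and> is_residue_fun m c f"
    by (intro exI[of _ "restrict f {..<m}"]) auto
next
  fix f g
  assume fg: "f \<in> {..<m} \<rightarrow>\<^sub>E UNIV \<and> is_residue_fun m c f" "g \<in> {..<m} \<rightarrow>\<^sub>E UNIV \<and> is_residue_fun m c g"
  show "f = g"
    by (rule PiE_ext[of _ "{..<m}" "\<lambda>_. UNIV"])
      (use fg is_residue_fun_unique[OF m cop, of f g] in auto)
qed

end

theory Submission imports Defs begin

text \<open>
  Since \<open>c\<close> generates the integers modulo \<open>m\<close>, condition (2) and \<open>f 0 = 0\<close> already determine \<open>f\<close>.
  So it suffices that the right-hand side of the first formula satisfies the recurrence (2) modulo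
  \<open>n\<close>. As long as \<open>l + d < n\<close> this is a polynomial identity, because the remainder \<open>q\<close> does not
  change; when \<open>l + d\<close> wraps around to \<open>l + d - n < d\<close>, it is the recurrence (2) for \<open>d\<close> and \<open>t\<close>,
  because \<open>n\<close> is congruent to \<open>t\<close> modulo \<open>d\<close>. Reading (2) backwards gives
  \<open>f\<^bsub>n-d\<^esub>(l) = 2 l - f\<^bsub>d\<^esub>(l)\<close>, which turns the first formula into the second.
\<close>

lemma is_residue_fun_residue_fun:
  assumes "1 \<le> m" "coprime c m"
  shows "is_residue_fun m c (residue_fun m c)"
  unfolding residue_fun_def using theI'[OF residue_fun_ex1[OF assms]] by blast

lemma residue_fun_0:
  assumes "1 \<le> m" "coprime c m"
  shows "residue_fun m c 0 = 0"
  using is_residue_fun_residue_fun[OF assms] by (simp add: is_residue_fun_def)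

lemma residue_fun_step:
  assumes "1 \<le> m" "coprime c m" "l < m"
  shows "residue_fun m c ((l + c) mod m) = residue_fun m c l + int m - 1 - 2 * int l"
proof -
  have "residue_fun m c ((l + c) mod m) + int l = residue_fun m c l + int m - 1 - int l"
    using is_residue_fun_residue_fun[OF assms(1,2)] assms(3) unfolding is_residue_fun_def by blast
  then show ?thesis by linarith
qed

text \<open>The candidate \<open>g\<close> is real-valued so that a quotient by \<open>d\<close> can
  be compared before it is known to be an integer.\<close>

lemma residue_fun_eqI:
  fixes g :: "nat \<Rightarrow> real"
  assumes m: "1 \<le> m" and cop: "coprime c m" and g0: "g 0 = 0"
    and step: "\<And>l. l < m \<Longrightarrow> g ((l + c) mod m) = g l + real m - 1 - 2 * real l"
    and l: "l < m"
  shows "real_of_int (residue_fun m c l) = g l"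
proof -
  have eq: "real_of_int (residue_fun m c (j * c mod m)) = g (j * c mod m)" for j
  proof (induction j)
    case 0
    then show ?case by (simp add: g0 residue_fun_0[OF m cop])
  next
    case (Suc j)
    have lt: "j * c mod m < m" using m by simp
    have e: "Suc j * c mod m = (j * c mod m + c) mod m"
      by (simp add: mod_add_right_eq add.commute)
    show ?case
      unfolding e residue_fun_step[OF m cop lt] step[OF lt] using Suc.IH by simp
  qed
  \<comment> \<open>With \<open>c'\<close> inverse to \<open>c\<close>, the point \<open>l\<close>
    is reached from 0 after \<open>l * c'\<close> steps.\<close>
  obtain c' where "[c * c' = 1] (mod m)"
    using cong_solve_coprime_nat[OF cop] by auto
  then have "[l * (c * c') = l * 1] (mod m)" by (rule cong_scalar_left)
  then have "(l * c') * c mod m = l"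
    using l by (simp add: cong_def ac_simps)
  with eq[of "l * c'"] show ?thesis by simp
qed

lemma residue_fun_reflect:
  assumes m: "1 \<le> m" and cop: "coprime c m" and c: "c \<le> m" and l: "l < m"
  shows "residue_fun m (m - c) l = 2 * int l - residue_fun m c l"
proof -
  have cop': "coprime (m - c) m"
    using cop c by (metis coprime_commute coprime_diff_one_left_nat coprime_iff_gcd_eq_1 gcd_diff1_nat
        gcd.commute gcd_diff2_nat)
  have "real_of_int (residue_fun m (m - c) l) = 2 * real l - real_of_int (residue_fun m c l)"
  proof (rule residue_fun_eqI[OF m cop' _ _ l])
    fix k assume k: "k < m"
    \<comment> \<open>\<open>k'\<close> is the predecessor of \<open>k\<close> under adding
      \<open>c\<close>; the step from \<open>k'\<close> to \<open>k\<close> gives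
      \<open>2 * k' - f k' = m - 1 - f k\<close>, with \<open>f\<close> the function for
      \<open>c\<close>.\<close>
    define k' where "k' = (k + (m - c)) mod m"
    have k': "k' < m" using m by (simp add: k'_def)
    have "(k' + c) mod m = k"
      using c k by (simp add: k'_def mod_add_left_eq)
    then have "residue_fun m c k = residue_fun m c k' + int m - 1 - 2 * int k'"
      using residue_fun_step[OF m cop k'] by simp
    then have "real_of_int (residue_fun m c k)
        = real_of_int (residue_fun m c k') + real m - 1 - 2 * real k'" by simp
    then show "2 * real k' - real_of_int (residue_fun m c k')
        = 2 * real k - real_of_int (residue_fun m c k) + real m - 1 - 2 * real k" by simp
  qed (simp add: residue_fun_0[OF m cop])
  then show ?thesis by linarith
qed

lemma residue_fun_euclid_step:
  assumes d: "1 \<le> d" "d < n" and cop: "coprime d n" and l: "l < n"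
  shows "real_of_int (residue_fun n d l) =
    (real l * (real n + real d - 1 - real l)
      - real n * real_of_int (residue_fun d (n mod d) (l mod d))) / real d"
proof (rule residue_fun_eqI[OF _ cop _ _ l])
  have cop': "coprime (n mod d) d"
    using cop d by (simp add: coprime_commute)
  note F_step = residue_fun_step[OF d(1) cop']
  show "1 \<le> n" using d by simp
  show "(real 0 * (real n + real d - 1 - real 0)
      - real n * real_of_int (residue_fun d (n mod d) (0 mod d))) / real d = 0"
    by (simp add: residue_fun_0[OF d(1) cop'])
  fix k assume k: "k < n"
  define F where "F i = real_of_int (residue_fun d (n mod d) i)" for i
  define g where "g i = (real i * (real n + real d - 1 - real i) - real n * F (i mod d)) / real d"
    for i
  have "g ((k + d) mod n) = g k + real n - 1 - 2 * real k"
  proof (cases "k + d < n")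
    case True
    \<comment> \<open>The \<open>F\<close> terms cancel, and the quadratic part of the numerator
      grows by \<open>d * (n - 1 - 2 * k)\<close>.\<close>
    then show ?thesis using d by (simp add: g_def field_simps)
  next
    case False
    \<comment> \<open>Since \<open>k < n\<close>, the wrapped point is below \<open>d\<close>, so it
      is its own remainder. Adding \<open>n mod d\<close> carries it to \<open>k mod d\<close>: the
      recurrence for \<open>d\<close> runs from the new point back to the old one.\<close>
    define k' where "k' = k + d - n"
    have k': "k' < d" "k + d = k' + n" using False k by (auto simp: k'_def)
    have "(k' + n mod d) mod d = k mod d"
      using k'(2) by (metis mod_add_right_eq mod_add_self2)
    with F_step[OF k'(1)] have F: "F (k mod d) = F k' + real d - 1 - 2 * real k'"
      by (simp add: F_def)
    have "(k + d) mod n = k'" using k' d by simp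
    moreover have rk: "real k = real k' + real n - real d" using k'(2) by linarith
    ultimately show ?thesis
      using d k' unfolding g_def by (simp add: F rk field_simps)
  qed
  then show "(real ((k + d) mod n) * (real n + real d - 1 - real ((k + d) mod n))
        - real n * real_of_int (residue_fun d (n mod d) ((k + d) mod n mod d))) / real d
      = (real k * (real n + real d - 1 - real k)
        - real n * real_of_int (residue_fun d (n mod d) (k mod d))) / real d
        + real n - 1 - 2 * real k"
    by (simp add: g_def F_def)
qed

theorem theorem6p4:
  fixes n d l s t p q :: nat
  assumes "n \<ge> 2"
    and "d \<in> {..<n}" and "coprime d n"
    and "l \<in> {..<n}"
    and "n = s * d + t" and "t \<in> {..<d}"
    and "l = p * d + q" and "q \<in> {..<d}"
  shows "real_of_int (residue_fun n d l) =
           real l * (real n + real d - 1 - real l) / real d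
             - real n / real d * real_of_int (residue_fun d t q)
       \<and> real_of_int (residue_fun n (n - d) l) =
           real n / real d * real_of_int (residue_fun d t q)
             - real l * (real n - real d - 1 - real l) / real d"
proof -
  have d: "1 \<le> d" "d < n" and l: "l < n" and n: "1 \<le> n" using assms by auto
  have nt: "n mod d = t" using assms(5,6) by simp
  have lq: "l mod d = q" using assms(7,8) by simp
  have *: "real_of_int (residue_fun n d l) =
      (real l * (real n + real d - 1 - real l) - real n * real_of_int (residue_fun d t q)) / real d"
    using residue_fun_euclid_step[OF d assms(3) l] unfolding nt lq .
  have "residue_fun n (n - d) l = 2 * int l - residue_fun n d l"
    using residue_fun_reflect[OF n assms(3) _ l] d by simp
  then have **: "real_of_int (residue_fun n (n - d) l)
      = 2 * real l - real_of_int (residue_fun n d l)" by simp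
  \<comment> \<open>Writing \<open>2 * l\<close> as \<open>l * (2 * d) / d\<close> turns the factor
    \<open>n + d - 1 - l\<close> into \<open>n - d - 1 - l\<close>.\<close>
  show ?thesis
    unfolding ** * using d by (simp add: diff_divide_distrib add_divide_distrib algebra_simps)
qed

end
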